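(* Let $G\le\mathrm{Aut}\,T$ be a branch group with the congruence subgroup property, and suppose for some $s\ge 2$ that $\mathrm{Bas}_s(G)$ also has the congruence subgroup property. If $H$ is a dense subgroup of $G$, then $\mathrm{Bas}_s(H)$ is dense in $\mathrm{Bas}_s(G)$ (density being with respect to the profinite topologies of $G$ and of $\mathrm{Bas}_s(G)$, respectively).
   Context: Let $T$ be the binary rooted tree: its vertices are the finite words over $X=\{0,1\}$, the root is the empty word $\epsilon$, and each word $v$ is joined to $v0$ and $v1$. $\mathrm{Aut}\,T$ is the group of root-fixing graph automorphisms of $T$, acting on the left. For $g\in\mathrm{Aut}\,T$ and a vertex $v$, the section $g|_v\in\mathrm{Aut}\,T$ is defined by $g(vw)=g(v)\,g|_v(w)$ for all words $w$. One writes $g=(g|_0,g|_1)\,g|^\epsilon$, where $g|^\epsilon\in\mathrm{Sym}(\{0,1\})$ is the action of $g$ on the first level; $(x,y)$ denotes the automorphism fixing $0$ and $1$ with sections $x$ at $0$ and $y$ at $1$. For $s\ge 2$ and $G\le \mathrm{Aut}\,T$, the $s$th Basilica group of $G$ is $\mathrm{Bas}_s(G)=\langle \beta_i^s(g)\mid g\in G,\ 0\le i\le s-1\rangle$, where the monomorphisms $\beta_i^s:\mathrm{Aut}\,T\to\mathrm{Aut}\,T$ are defined recursively by $\beta_i^s(g)=(\beta_{i-1}^s(g),1)$ for $1\le i\le s-1$ and $\beta_0^s(g)=(\beta_{s-1}^s(g|_0),\beta_{s-1}^s(g|_1))\,g|^\epsilon$. For $G\le\mathrm{Aut}\,T$: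 $\mathrm{St}_G(n)$ is the subgroup of elements fixing every word of length $n$. $G$ has the congruence subgroup property if every finite-index subgroup of $G$ contains some $\mathrm{St}_G(n)$. The rigid vertex stabiliser of a vertex $v$ is the subgroup of elements of $G$ fixing every vertex outside the subtree $\{vw\mid w\in X^*\}$, and $\mathrm{Rist}_G(n)$ is the subgroup generated by the rigid vertex stabilisers of all $v\in X^n$. $G$ is branch if it acts transitively on every level $X^n$ and, for every $n$, $\mathrm{Rist}_G(n)$ is non-trivial and of finite index in $G$. The profinite topology on a group is the one with a base of neighbourhoods of the identity given by the finite-index normal subgroups. *)

theory Defs
  imports "HOL-Analysis.Abstract_Topology" "HOL-Algebra.Generated_Groups" "HOL-Library.Sublist"
begin

section \<open>The binary rooted tree and its automorphisms\<close>

text \<open>The letters 0 and 1 are \<open>False\<close> and \<open>True\<close>. Words are read from the root, so that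
  the children of \<open>v\<close> are \<open>v @ [False]\<close> and \<open>v @ [True]\<close>.\<close>

type_synonym vertex = "bool list"

definition tree_adj :: "vertex \<Rightarrow> vertex \<Rightarrow> bool" where
  "tree_adj u v \<longleftrightarrow> (\<exists>x. v = u @ [x] \<or> u = v @ [x])"

definition AutT :: "(vertex \<Rightarrow> vertex) monoid" where
  "AutT = \<lparr> carrier = {g. bij g \<and> g [] = [] \<and> (\<forall>u v. tree_adj (g u) (g v) \<longleftrightarrow> tree_adj u v)},
            mult = (\<circ>), one = id \<rparr>"

abbreviation as_group :: "(vertex \<Rightarrow> vertex) set \<Rightarrow> (vertex \<Rightarrow> vertex) monoid" where
  "as_group G \<equiv> AutT\<lparr>carrier := G\<rparr>"

definition sect :: "(vertex \<Rightarrow> vertex) \<Rightarrow> vertex \<Rightarrow> vertex \<Rightarrow> vertex" where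
  "sect g v = (\<lambda>w. THE u. g (v @ w) = g v @ u)"

definition root_perm :: "(vertex \<Rightarrow> vertex) \<Rightarrow> bool \<Rightarrow> bool" where
  "root_perm g x = hd (g [x])"

text \<open>\<open>decomp a b p\<close> is the map written \<open>(a, b) p\<close>: the sections at 0 and 1 are \<open>a\<close> and \<open>b\<close>, and
  \<open>p\<close> is the action on the first level.\<close>

fun decomp :: "(vertex \<Rightarrow> vertex) \<Rightarrow> (vertex \<Rightarrow> vertex) \<Rightarrow> (bool \<Rightarrow> bool) \<Rightarrow> vertex \<Rightarrow> vertex" where
  "decomp a b p [] = []"
| "decomp a b p (x # w) = p x # (if x then b w else a w)"


section \<open>Basilica groups\<close>

text \<open>The recursive definition of the maps \<open>\<beta>\<close> is evaluated along the word they are applied to;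
  \<open>beta_Suc\<close> and \<open>beta_0\<close> below are the defining equations in terms of decompositions.\<close>

fun beta :: "nat \<Rightarrow> nat \<Rightarrow> (vertex \<Rightarrow> vertex) \<Rightarrow> vertex \<Rightarrow> vertex" where
  "beta s i g [] = []"
| "beta s 0 g (x # w) = root_perm g x # beta s (s - 1) (sect g [x]) w"
| "beta s (Suc i) g (x # w) = x # (if x then w else beta s i g w)"

lemma beta_Suc: "beta s (Suc i) g = decomp (beta s i g) id id"
proof
  fix w show "beta s (Suc i) g w = decomp (beta s i g) id id w" by (cases w) auto
qed

lemma beta_0:
  "beta s 0 g = decomp (beta s (s - 1) (sect g [False])) (beta s (s - 1) (sect g [True])) (root_perm g)"
proof
  fix w
  show "beta s 0 g w
      = decomp (beta s (s - 1) (sect g [False])) (beta s (s - 1) (sect g [True])) (root_perm g) w"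
    by (cases w) auto
qed

definition Bas :: "nat \<Rightarrow> (vertex \<Rightarrow> vertex) set \<Rightarrow> (vertex \<Rightarrow> vertex) set" where
  "Bas s G = generate AutT {beta s i g | i g. g \<in> G \<and> i \<le> s - 1}"


section \<open>Congruence subgroups, branch groups, profinite topology\<close>

definition level_stab :: "(vertex \<Rightarrow> vertex) set \<Rightarrow> nat \<Rightarrow> (vertex \<Rightarrow> vertex) set" where
  "level_stab G n = {g \<in> G. \<forall>w. length w = n \<longrightarrow> g w = w}"

definition finite_index :: "('a, 'b) monoid_scheme \<Rightarrow> 'a set \<Rightarrow> bool" where
  "finite_index \<Gamma> K \<longleftrightarrow> subgroup K \<Gamma> \<and> finite (rcosets\<^bsub>\<Gamma>\<^esub> K)"

definition congruence_subgroup_property :: "(vertex \<Rightarrow> vertex) set \<Rightarrow> bool" where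
  "congruence_subgroup_property G \<longleftrightarrow>
     (\<forall>K. finite_index (as_group G) K \<longrightarrow> (\<exists>n. level_stab G n \<subseteq> K))"

definition rigid_vertex_stab :: "(vertex \<Rightarrow> vertex) set \<Rightarrow> vertex \<Rightarrow> (vertex \<Rightarrow> vertex) set" where
  "rigid_vertex_stab G v = {g \<in> G. \<forall>u. \<not> prefix v u \<longrightarrow> g u = u}"

definition rigid_level_stab :: "(vertex \<Rightarrow> vertex) set \<Rightarrow> nat \<Rightarrow> (vertex \<Rightarrow> vertex) set" where
  "rigid_level_stab G n = generate AutT (\<Union>v\<in>{v. length v = n}. rigid_vertex_stab G v)"

definition branch_group :: "(vertex \<Rightarrow> vertex) set \<Rightarrow> bool" where
  "branch_group G \<longleftrightarrow> subgroup G AutT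
     \<and> (\<forall>u v. length u = length v \<longrightarrow> (\<exists>g\<in>G. g u = v))
     \<and> (\<forall>n. rigid_level_stab G n \<noteq> {\<one>\<^bsub>AutT\<^esub>} \<and> finite_index (as_group G) (rigid_level_stab G n))"

definition profinite_topology :: "('a, 'b) monoid_scheme \<Rightarrow> 'a topology" where
  "profinite_topology \<Gamma> = topology (\<lambda>U. U \<subseteq> carrier \<Gamma> \<and>
     (\<forall>x\<in>U. \<exists>N. N \<lhd> \<Gamma> \<and> finite_index \<Gamma> N \<and> x <#\<^bsub>\<Gamma>\<^esub> N \<subseteq> U))"

definition profinitely_dense :: "('a, 'b) monoid_scheme \<Rightarrow> 'a set \<Rightarrow> bool" where
  "profinitely_dense \<Gamma> S \<longleftrightarrow> S \<subseteq> carrier \<Gamma> \<and> profinite_topology \<Gamma> closure_of S = carrier \<Gamma>"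


section \<open>Well-definedness\<close>

lemma finite_index_Int:
  assumes "group \<Gamma>" "finite_index \<Gamma> N" "finite_index \<Gamma> M"
  shows "finite_index \<Gamma> (N \<inter> M)"
proof -
  interpret group \<Gamma> by fact
  have sub: "subgroup N \<Gamma>" "subgroup M \<Gamma>"
    and fin: "finite (rcosets\<^bsub>\<Gamma>\<^esub> N)" "finite (rcosets\<^bsub>\<Gamma>\<^esub> M)"
    using assms by (auto simp: finite_index_def)
  have eq: "(N \<inter> M) #>\<^bsub>\<Gamma>\<^esub> a = (N #>\<^bsub>\<Gamma>\<^esub> a) \<inter> (M #>\<^bsub>\<Gamma>\<^esub> a)" if a: "a \<in> carrier \<Gamma>" for a
  proof
    show "(N #>\<^bsub>\<Gamma>\<^esub> a) \<inter> (M #>\<^bsub>\<Gamma>\<^esub> a) \<subseteq> (N \<inter> M) #>\<^bsub>\<Gamma>\<^esub> a"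
    proof
      fix z assume "z \<in> (N #>\<^bsub>\<Gamma>\<^esub> a) \<inter> (M #>\<^bsub>\<Gamma>\<^esub> a)"
      then obtain h k where "h \<in> N" "k \<in> M" "z = h \<otimes>\<^bsub>\<Gamma>\<^esub> a" "z = k \<otimes>\<^bsub>\<Gamma>\<^esub> a"
        by (auto simp: r_coset_def)
      moreover from this have "h = k"
        using a sub by (metis subgroup.mem_carrier right_cancel)
      ultimately show "z \<in> (N \<inter> M) #>\<^bsub>\<Gamma>\<^esub> a" by (auto simp: r_coset_def)
    qed
  qed (auto simp: r_coset_def)
  have "rcosets\<^bsub>\<Gamma>\<^esub> (N \<inter> M) \<subseteq> (\<lambda>(A, B). A \<inter> B) ` ((rcosets\<^bsub>\<Gamma>\<^esub> N) \<times> (rcosets\<^bsub>\<Gamma>\<^esub> M))"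
    using eq by (fastforce simp: RCOSETS_def)
  then show ?thesis
    using sub fin by (auto simp: finite_index_def subgroups_Inter_pair intro: finite_subset)
qed

lemma openin_profinite_topology:
  assumes "group \<Gamma>"
  shows "openin (profinite_topology \<Gamma>) U \<longleftrightarrow> U \<subseteq> carrier \<Gamma> \<and>
     (\<forall>x\<in>U. \<exists>N. N \<lhd> \<Gamma> \<and> finite_index \<Gamma> N \<and> x <#\<^bsub>\<Gamma>\<^esub> N \<subseteq> U)"
proof -
  interpret group \<Gamma> by fact
  let ?O = "\<lambda>U. U \<subseteq> carrier \<Gamma> \<and> (\<forall>x\<in>U. \<exists>N. N \<lhd> \<Gamma> \<and> finite_index \<Gamma> N \<and> x <#\<^bsub>\<Gamma>\<^esub> N \<subseteq> U)"
  have "istopology ?O"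
    unfolding istopology_def
  proof (intro conjI allI impI)
    fix S T assume S: "?O S" and T: "?O T"
    show "S \<inter> T \<subseteq> carrier \<Gamma>" using S by auto
    show "\<forall>x\<in>S \<inter> T. \<exists>N. N \<lhd> \<Gamma> \<and> finite_index \<Gamma> N \<and> x <#\<^bsub>\<Gamma>\<^esub> N \<subseteq> S \<inter> T"
    proof
      fix x assume "x \<in> S \<inter> T"
      then obtain N M where "N \<lhd> \<Gamma>" "finite_index \<Gamma> N" "x <#\<^bsub>\<Gamma>\<^esub> N \<subseteq> S"
        "M \<lhd> \<Gamma>" "finite_index \<Gamma> M" "x <#\<^bsub>\<Gamma>\<^esub> M \<subseteq> T" using S T by blast
      then have "N \<inter> M \<lhd> \<Gamma> \<and> finite_index \<Gamma> (N \<inter> M) \<and> x <#\<^bsub>\<Gamma>\<^esub> (N \<inter> M) \<subseteq> S \<inter> T"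
        using finite_index_Int[OF assms] by (auto simp: l_coset_def normal_inv_iff subgroups_Inter_pair)
      then show "\<exists>N. N \<lhd> \<Gamma> \<and> finite_index \<Gamma> N \<and> x <#\<^bsub>\<Gamma>\<^esub> N \<subseteq> S \<inter> T" by blast
    qed
  next
    fix K assume "\<forall>U\<in>K. ?O U"
    then show "\<Union>K \<subseteq> carrier \<Gamma>"
      and "\<forall>x\<in>\<Union>K. \<exists>N. N \<lhd> \<Gamma> \<and> finite_index \<Gamma> N \<and> x <#\<^bsub>\<Gamma>\<^esub> N \<subseteq> \<Union>K"
      by (blast, meson Union_iff Union_upper subset_trans)
  qed
  then show ?thesis by (simp add: profinite_topology_def topology_inverse')
qed

lemma group_AutT: "group AutT"
proof (rule groupI)
  fix g assume g: "g \<in> carrier AutT"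
  then have b: "bij g" by (simp add: AutT_def)
  define h where "h = inv_into UNIV g"
  have hg: "h (g u) = u" and gh: "g (h u) = u" for u
    using b by (simp_all add: h_def bij_is_inj bij_is_surj surj_f_inv_f)
  have adj: "tree_adj (g u) (g v) = tree_adj u v" for u v using g by (simp add: AutT_def)
  have "tree_adj (h u) (h v) = tree_adj u v" for u v using adj[of "h u" "h v"] by (simp add: gh)
  moreover have "h [] = []" using g hg[of "[]"] by (simp add: AutT_def)
  moreover have "bij h" using b by (simp add: h_def bij_imp_bij_inv)
  moreover have "h \<circ> g = id" using hg by auto
  ultimately have "h \<in> carrier AutT" "h \<otimes>\<^bsub>AutT\<^esub> g = \<one>\<^bsub>AutT\<^esub>"
    by (auto simp: AutT_def)
  then show "\<exists>h\<in>carrier AutT. h \<otimes>\<^bsub>AutT\<^esub> g = \<one>\<^bsub>AutT\<^esub>" by blast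
qed (auto simp: AutT_def bij_comp comp_assoc)

lemma AutT_child:
  assumes g: "g \<in> carrier AutT"
  shows "\<exists>y. g (v @ [x]) = g v @ [y]"
proof (induction v arbitrary: x rule: rev_induct)
  case Nil
  have "tree_adj [] [x]" by (simp add: tree_adj_def)
  moreover have "tree_adj (g u) (g v) = tree_adj u v" for u v using g by (simp add: AutT_def)
  ultimately have "tree_adj (g []) (g [x])" by blast
  moreover have "g [] = []" using g by (simp add: AutT_def)
  ultimately show ?case by (auto simp: tree_adj_def)
next
  case (snoc z v)
  have "tree_adj (v @ [z]) ((v @ [z]) @ [x])" by (simp add: tree_adj_def)
  then have "tree_adj (g (v @ [z])) (g ((v @ [z]) @ [x]))" using g unfolding AutT_def by simp
  then consider y where "g ((v @ [z]) @ [x]) = g (v @ [z]) @ [y]"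
    | y where "g (v @ [z]) = g ((v @ [z]) @ [x]) @ [y]" by (auto simp: tree_adj_def)
  then show ?case
  proof cases
    case 2
    then have "g ((v @ [z]) @ [x]) = g v" using snoc[of z] by auto
    then have "(v @ [z]) @ [x] = v" using g by (metis (no_types, lifting) AutT_def bij_pointE mem_Collect_eq partial_object.select_convs(1))
    then show ?thesis by simp
  qed auto
qed

lemma AutT_append:
  assumes g: "g \<in> carrier AutT"
  shows "\<exists>u. g (v @ w) = g v @ u \<and> length u = length w"
proof (induction w rule: rev_induct)
  case (snoc x w)
  then show ?case using AutT_child[OF g, of "v @ w" x] by auto
qed simp

lemma sect_append:
  assumes g: "g \<in> carrier AutT"
  shows "g (v @ w) = g v @ sect g v w"
proof -
  obtain u where "g (v @ w) = g v @ u" using AutT_append[OF g] by blast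
  then show ?thesis by (simp add: sect_def)
qed

lemma length_AutT: "g \<in> carrier AutT \<Longrightarrow> length (g v) = length v"
  using AutT_append[of g "[]" v] by (auto simp: AutT_def)

lemma sect_in_AutT:
  assumes g: "g \<in> carrier AutT"
  shows "sect g v \<in> carrier AutT"
proof -
  have bg: "bij g" using g by (simp add: AutT_def)
  have "inj (sect g v)"
  proof (rule injI)
    fix a b assume "sect g v a = sect g v b"
    then have "g (v @ a) = g (v @ b)" using sect_append[OF g] by metis
    then show "a = b" using bg by (metis bij_pointE same_append_eq)
  qed
  moreover have "\<exists>a. sect g v a = y" for y
  proof -
    obtain t where t: "g t = g v @ y" using bg by (metis bij_pointE)
    have l: "length t = length v + length y" using length_AutT[OF g] t by (metis length_append)
    define t1 t2 where "t1 = take (length v) t" and "t2 = drop (length v) t"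
    have "t = t1 @ t2" "length t1 = length v" using l by (auto simp: t1_def t2_def)
    then have "g t1 @ sect g t1 t2 = g v @ y" "length (g t1) = length (g v)"
      using t sect_append[OF g] length_AutT[OF g] by auto
    then have "g t1 = g v" "sect g t1 t2 = y" by auto
    moreover from this have "t1 = v" using bg by (metis bij_pointE)
    ultimately show ?thesis by auto
  qed
  ultimately have "bij (sect g v)" by (metis bij_def surj_def)
  moreover have "sect g v [] = []" using sect_append[OF g, of v "[]"] by simp
  moreover have "tree_adj (sect g v a) (sect g v b) = tree_adj a b" for a b
  proof -
    have "tree_adj (g (v @ a)) (g (v @ b)) = tree_adj (v @ a) (v @ b)" using g by (simp add: AutT_def)
    then show ?thesis by (simp add: sect_append[OF g] tree_adj_def)
  qed
  ultimately show ?thesis by (simp add: AutT_def)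
qed

lemma root_perm_AutT: "g \<in> carrier AutT \<Longrightarrow> g [x] = [root_perm g x]"
  using length_AutT[of g "[x]"] by (cases "g [x]") (auto simp: root_perm_def)

lemma AutT_decomp:
  assumes g: "g \<in> carrier AutT"
  shows "g = decomp (sect g [False]) (sect g [True]) (root_perm g)"
proof
  fix w show "g w = decomp (sect g [False]) (sect g [True]) (root_perm g) w"
  proof (cases w)
    case Nil then show ?thesis using g by (simp add: AutT_def)
  next
    case (Cons x w')
    then show ?thesis using sect_append[OF g, of "[x]" w'] by (simp add: root_perm_AutT[OF g])
  qed
qed

lemma comp_in_AutT: "g \<in> carrier AutT \<Longrightarrow> h \<in> carrier AutT \<Longrightarrow> g \<circ> h \<in> carrier AutT"
  using monoid.m_closed[OF group.is_monoid[OF group_AutT], of g h] by (simp add: AutT_def)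

lemma AutT_comp_one: "g \<otimes>\<^bsub>AutT\<^esub> h = g \<circ> h" "\<one>\<^bsub>AutT\<^esub> = id"
  by (simp_all add: AutT_def)

lemma sect_comp:
  assumes g: "g \<in> carrier AutT" and h: "h \<in> carrier AutT"
  shows "sect (g \<circ> h) v = sect g (h v) \<circ> sect h v"
proof
  fix w
  have "(g \<circ> h) (v @ w) = g (h v) @ sect g (h v) (sect h v w)"
    by (simp add: sect_append[OF g] sect_append[OF h])
  then show "sect (g \<circ> h) v w = (sect g (h v) \<circ> sect h v) w"
    using sect_append[OF comp_in_AutT[OF g h], of v w] by simp
qed

lemma beta_comp:
  assumes "g \<in> carrier AutT" "h \<in> carrier AutT"
  shows "beta s i (g \<circ> h) w = beta s i g (beta s i h w)"
  using assms
proof (induction s i h w arbitrary: g rule: beta.induct)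
  case (2 s h x w)
  have "root_perm (g \<circ> h) x = root_perm g (root_perm h x)"
    using root_perm_AutT[OF 2(3), of x] by (simp add: root_perm_def)
  then show ?case
    using 2(1)[OF sect_in_AutT[OF 2(2)] sect_in_AutT[OF 2(3)], of "h [x]"]
    by (simp del: comp_apply add: sect_comp[OF 2(2,3)] root_perm_AutT[OF 2(3)])
qed auto

lemma beta_id: "beta s i id w = w"
proof (induction s i "id :: vertex \<Rightarrow> vertex" w rule: beta.induct)
  case (2 s x w)
  have "sect id [x] = id" by (auto simp: sect_def)
  then show ?case using 2 by (simp add: root_perm_def)
qed auto

lemma beta_child: "\<exists>y. beta s i g (w @ [x]) = beta s i g w @ [y]"
proof (induction s i g w rule: beta.induct)
  case (1 s i g)
  show ?case by (cases i) auto
qed auto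

lemma beta_in_AutT:
  assumes g: "g \<in> carrier AutT"
  shows "beta s i g \<in> carrier AutT"
proof -
  interpret group AutT by (rule group_AutT)
  define h where "h = inv\<^bsub>AutT\<^esub> g"
  have h: "h \<in> carrier AutT" "g \<circ> h = id" "h \<circ> g = id"
    using g r_inv[OF g] l_inv[OF g] by (simp_all add: h_def AutT_comp_one)
  have inv1: "beta s i g (beta s i h w) = w" and inv2: "beta s i h (beta s i g w) = w" for w
    using beta_comp[OF g h(1), of s i w] beta_comp[OF h(1) g, of s i w] h by (auto simp: beta_id)
  have adj: "tree_adj (beta s i k u) (beta s i k v)" if "tree_adj u v" for k u v
    using that beta_child[of s i k] unfolding tree_adj_def by metis
  have "bij (beta s i g)" using inv1 inv2 by (metis bijI')
  moreover have "tree_adj (beta s i g u) (beta s i g v) = tree_adj u v" for u v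
    using adj[of u v g] adj[of "beta s i g u" "beta s i g v" h] inv2 by auto
  ultimately show ?thesis by (simp add: AutT_def)
qed

lemma subgroup_Bas:
  assumes "subgroup G AutT"
  shows "subgroup (Bas s G) AutT"
  unfolding Bas_def
  using assms by (intro group.generate_is_subgroup group_AutT)
    (auto intro: beta_in_AutT dest: subgroup.mem_carrier)

end

theory Submission
  imports Defs
begin

text \<open>For a subgroup \<open>G\<close> of \<open>AutT\<close>, every level stabiliser is a normal subgroup of finite index:
  its cosets are the classes of elements with the same action on that level, and a level has only
  finitely many words. Hence a profinitely dense subgroup \<open>H\<close> of \<open>G\<close> realises the action of every
  element of \<open>G\<close> on every level (\<open>dense_imp_agree\<close>). The maps \<open>\<beta>\<close> are computed letter by letter,
  so the action of \<open>beta s i g\<close> on level \<open>n\<close> is determined by the action of \<open>g\<close> on level \<open>n\<close>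
  (\<open>beta_agree\<close>). So every generator of \<open>Bas s G\<close>, and then every element
  (\<open>generate_agree\<close>), acts on level \<open>n\<close> like some element of \<open>Bas s H\<close>.

  This says that \<open>Bas s H\<close> is dense in \<open>Bas s G\<close> for the topology given by the level stabilisers.
  The congruence subgroup property of \<open>Bas s G\<close> says that this topology refines the profinite one,
  so \<open>Bas s H\<close> is profinitely dense.\<close>

section \<open>Profinite density in terms of cosets\<close>

lemma profinitely_dense_iff:
  assumes "group \<Gamma>"
  shows "profinitely_dense \<Gamma> S \<longleftrightarrow> S \<subseteq> carrier \<Gamma> \<and>
    (\<forall>x\<in>carrier \<Gamma>. \<forall>N. N \<lhd> \<Gamma> \<longrightarrow> finite_index \<Gamma> N \<longrightarrow> (\<exists>y\<in>S. y \<in> x <#\<^bsub>\<Gamma>\<^esub> N))"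
proof -
  interpret group \<Gamma> by fact
  note op = openin_profinite_topology[OF assms]
  have coset_open: "openin (profinite_topology \<Gamma>) (x <#\<^bsub>\<Gamma>\<^esub> N)"
    if x: "x \<in> carrier \<Gamma>" and N: "N \<lhd> \<Gamma>" "finite_index \<Gamma> N" for x N
  proof -
    have sub: "subgroup N \<Gamma>" using N by (simp add: finite_index_def)
    have "y <#\<^bsub>\<Gamma>\<^esub> N = x <#\<^bsub>\<Gamma>\<^esub> N" if "y \<in> x <#\<^bsub>\<Gamma>\<^esub> N" for y
      using l_repr_independence[OF that x sub] by simp
    then show ?thesis
      unfolding op using N l_coset_subset_G[OF subgroup.subset[OF sub] x] by blast
  qed
  have self: "x \<in> x <#\<^bsub>\<Gamma>\<^esub> N" if "x \<in> carrier \<Gamma>" "finite_index \<Gamma> N" for x N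
    using that subgroup.one_closed[of N \<Gamma>] by (force simp: l_coset_def finite_index_def)
  have "openin (profinite_topology \<Gamma>) (carrier \<Gamma>)"
  proof -
    have "rcosets\<^bsub>\<Gamma>\<^esub> (carrier \<Gamma>) \<subseteq> {carrier \<Gamma>}"
      using coset_join2[OF _ subgroup_self] by (auto simp: RCOSETS_def)
    then have "finite (rcosets\<^bsub>\<Gamma>\<^esub> (carrier \<Gamma>))" by (rule finite_subset) simp
    then have "carrier \<Gamma> \<lhd> \<Gamma>" "finite_index \<Gamma> (carrier \<Gamma>)"
      using subgroup_self by (auto simp: normal_inv_iff finite_index_def)
    then show ?thesis unfolding op using l_coset_subset_G by blast
  qed
  then have "topspace (profinite_topology \<Gamma>) = carrier \<Gamma>"
    by (metis op openin_subset openin_topspace subset_antisym)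
  then have "profinitely_dense \<Gamma> S \<longleftrightarrow> S \<subseteq> carrier \<Gamma> \<and>
    (\<forall>x\<in>carrier \<Gamma>. \<forall>U. x \<in> U \<and> openin (profinite_topology \<Gamma>) U \<longrightarrow> (\<exists>y\<in>S. y \<in> U))"
    unfolding profinitely_dense_def closure_of_def by blast
  also have "\<dots> \<longleftrightarrow> S \<subseteq> carrier \<Gamma> \<and>
    (\<forall>x\<in>carrier \<Gamma>. \<forall>N. N \<lhd> \<Gamma> \<longrightarrow> finite_index \<Gamma> N \<longrightarrow> (\<exists>y\<in>S. y \<in> x <#\<^bsub>\<Gamma>\<^esub> N))"
    using coset_open self unfolding op by (smt (verit) subsetD)
  finally show ?thesis .
qed

section \<open>Agreement on a level\<close>

definition agree :: "nat \<Rightarrow> (vertex \<Rightarrow> vertex) \<Rightarrow> (vertex \<Rightarrow> vertex) \<Rightarrow> bool" where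
  "agree n g h \<longleftrightarrow> (\<forall>w. length w = n \<longrightarrow> g w = h w)"

lemma inv_AutT:
  assumes "g \<in> carrier AutT"
  shows "inv\<^bsub>AutT\<^esub> g \<in> carrier AutT" "g ((inv\<^bsub>AutT\<^esub> g) w) = w" "(inv\<^bsub>AutT\<^esub> g) (g w) = w"
proof -
  interpret group AutT by (rule group_AutT)
  show "inv\<^bsub>AutT\<^esub> g \<in> carrier AutT" using assms by simp
  show "g ((inv\<^bsub>AutT\<^esub> g) w) = w" "(inv\<^bsub>AutT\<^esub> g) (g w) = w"
    using r_inv[OF assms] l_inv[OF assms] by (metis AutT_comp_one comp_apply id_apply)+
qed

lemma agree_comp:
  assumes "g' \<in> carrier AutT" "agree n f f'" "agree n g g'"
  shows "agree n (f \<circ> g) (f' \<circ> g')"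
  using assms length_AutT by (auto simp: agree_def)

lemma agree_inv:
  assumes g: "g \<in> carrier AutT" and h: "h \<in> carrier AutT" and gh: "agree n g h"
  shows "agree n (inv\<^bsub>AutT\<^esub> g) (inv\<^bsub>AutT\<^esub> h)"
  unfolding agree_def
proof (intro allI impI)
  fix w :: vertex assume "length w = n"
  then have "length ((inv\<^bsub>AutT\<^esub> g) w) = n" using length_AutT[OF inv_AutT(1)[OF g]] by simp
  then have "h ((inv\<^bsub>AutT\<^esub> g) w) = w" using gh inv_AutT(2)[OF g] by (metis agree_def)
  then show "(inv\<^bsub>AutT\<^esub> g) w = (inv\<^bsub>AutT\<^esub> h) w" using inv_AutT(3)[OF h] by metis
qed

text \<open>Every shorter word is a prefix of a word of length \<open>n\<close>, and automorphisms preserve prefixes.\<close>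

lemma agree_le:
  assumes g: "g \<in> carrier AutT" and h: "h \<in> carrier AutT" and gh: "agree n g h"
    and m: "m \<le> n"
  shows "agree m g h"
  unfolding agree_def
proof (intro allI impI)
  fix w :: vertex assume w: "length w = m"
  let ?u = "replicate (n - m) False"
  have "g (w @ ?u) = h (w @ ?u)" using gh w m by (simp add: agree_def)
  then have "g w @ sect g w ?u = h w @ sect h w ?u"
    by (simp only: sect_append[OF g] sect_append[OF h])
  then show "g w = h w" using length_AutT[OF g] length_AutT[OF h] by simp
qed

text \<open>If each element of \<open>A\<close> acts on level \<open>n\<close> like one of \<open>B\<close>, replacing every letter of a product
  of elements of \<open>A\<close> and their inverses changes nothing on level \<open>n\<close>.\<close>

lemma generate_agree:
  assumes A: "A \<subseteq> carrier AutT" and B: "B \<subseteq> carrier AutT"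
    and AB: "\<And>a. a \<in> A \<Longrightarrow> \<exists>b\<in>B. agree n a b"
    and x: "x \<in> generate AutT A"
  shows "\<exists>y\<in>generate AutT B. agree n x y"
  using x
proof (induction rule: generate.induct)
  case one
  show ?case by (rule bexI[OF _ generate.one]) (simp add: agree_def)
next
  case (incl a)
  then show ?case using AB generate.incl by metis
next
  case (inv a)
  then obtain b where "b \<in> B" "agree n a b" using AB by blast
  then show ?case using inv A B agree_inv generate.inv by (metis subsetD)
next
  case (eng a1 a2)
  then obtain b1 b2 where b: "b1 \<in> generate AutT B" "b2 \<in> generate AutT B"
    and "agree n a1 b1" "agree n a2 b2" by blast
  moreover have "b2 \<in> carrier AutT"
    using group.generate_in_carrier[OF group_AutT B] b by blast
  ultimately have "agree n (a1 \<otimes>\<^bsub>AutT\<^esub> a2) (b1 \<otimes>\<^bsub>AutT\<^esub> b2)"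
    by (simp add: AutT_comp_one agree_comp)
  then show ?case using generate.eng[OF b] by blast
qed

section \<open>Level stabilisers as profinite neighbourhoods\<close>

lemma subgroup_level_stab:
  assumes "subgroup G AutT"
  shows "subgroup (level_stab G n) (as_group G)"
proof -
  interpret G: group "as_group G" by (rule subgroup.subgroup_is_group[OF assms group_AutT])
  have inv: "inv\<^bsub>as_group G\<^esub> g = inv\<^bsub>AutT\<^esub> g" if "g \<in> G" for g
    using group.m_inv_consistent[OF group_AutT assms that] .
  show ?thesis
  proof (rule G.subgroupI)
    show "level_stab G n \<noteq> {}"
      using subgroup.one_closed[OF assms] by (auto simp: level_stab_def AutT_comp_one)
  next
    fix g assume g: "g \<in> level_stab G n"
    then have "g \<in> carrier AutT" "g \<in> G"
      using subgroup.mem_carrier[OF assms] by (auto simp: level_stab_def)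
    then show "inv\<^bsub>as_group G\<^esub> g \<in> level_stab G n"
      using g inv inv_AutT(3) subgroup.m_inv_closed[OF assms]
      by (simp add: level_stab_def) metis
  next
    fix g h assume "g \<in> level_stab G n" "h \<in> level_stab G n"
    then show "g \<otimes>\<^bsub>as_group G\<^esub> h \<in> level_stab G n"
      using subgroup.m_closed[OF assms, of g h] by (auto simp: level_stab_def AutT_comp_one)
  qed (auto simp: level_stab_def)
qed

lemma normal_level_stab:
  assumes "subgroup G AutT"
  shows "level_stab G n \<lhd> as_group G"
proof -
  interpret G: group "as_group G" by (rule subgroup.subgroup_is_group[OF assms group_AutT])
  have "x \<otimes>\<^bsub>as_group G\<^esub> h \<otimes>\<^bsub>as_group G\<^esub> inv\<^bsub>as_group G\<^esub> x \<in> level_stab G n"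
    if x: "x \<in> G" and h: "h \<in> level_stab G n" for x h
  proof -
    have xc: "x \<in> carrier AutT" using subgroup.mem_carrier[OF assms x] .
    have "x \<otimes>\<^bsub>as_group G\<^esub> h \<otimes>\<^bsub>as_group G\<^esub> inv\<^bsub>as_group G\<^esub> x \<in> G"
      using x h by (metis (no_types, lifting) G.inv_closed G.m_closed level_stab_def mem_Collect_eq
          partial_object.select_convs(1) partial_object.surjective partial_object.update_convs(1))
    then show ?thesis
      using h x inv_AutT[OF xc] length_AutT[OF inv_AutT(1)[OF xc]]
        group.m_inv_consistent[OF group_AutT assms x]
      by (simp add: level_stab_def AutT_comp_one)
  qed
  then show ?thesis
    using subgroup_level_stab[OF assms] by (simp add: G.normal_inv_iff)
qed

text \<open>A coset of the stabiliser of level \<open>n\<close> is determined by the map it induces on the finite set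
  of words of length \<open>n\<close>.\<close>

lemma finite_index_level_stab:
  assumes G: "subgroup G AutT"
  shows "finite_index (as_group G) (level_stab G n)"
proof -
  let ?W = "{w :: vertex. length w = n}"
  let ?C = "\<lambda>f. {h \<in> G. \<forall>w\<in>?W. h w = f w}"
  have "level_stab G n #>\<^bsub>as_group G\<^esub> g = ?C (restrict g ?W)" if g: "g \<in> G" for g
  proof
    have gc: "g \<in> carrier AutT" using subgroup.mem_carrier[OF G g] .
    show "level_stab G n #>\<^bsub>as_group G\<^esub> g \<subseteq> ?C (restrict g ?W)"
      using subgroup.m_closed[OF G _ g] length_AutT[OF gc]
      by (auto simp: r_coset_def level_stab_def AutT_comp_one)
    show "?C (restrict g ?W) \<subseteq> level_stab G n #>\<^bsub>as_group G\<^esub> g"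
    proof
      fix h assume h: "h \<in> ?C (restrict g ?W)"
      have "h \<circ> inv\<^bsub>AutT\<^esub> g \<in> level_stab G n"
        using h g inv_AutT[OF gc] length_AutT[OF inv_AutT(1)[OF gc]]
          subgroup.m_closed[OF G, of h] subgroup.m_inv_closed[OF G g]
        by (simp add: level_stab_def AutT_comp_one)
      moreover have "h = (h \<circ> inv\<^bsub>AutT\<^esub> g) \<circ> g" using inv_AutT(3)[OF gc] by auto
      ultimately show "h \<in> level_stab G n #>\<^bsub>as_group G\<^esub> g"
        by (auto simp: r_coset_def AutT_comp_one)
    qed
  qed
  moreover have "restrict g ?W \<in> ?W \<rightarrow>\<^sub>E ?W" if "g \<in> G" for g
    using length_AutT[OF subgroup.mem_carrier[OF G that]] by auto
  ultimately have "level_stab G n #>\<^bsub>as_group G\<^esub> g \<in> ?C ` (?W \<rightarrow>\<^sub>E ?W)"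
    if "g \<in> carrier (as_group G)" for g
    by (rule image_eqI) (use that in simp_all)
  then have "rcosets\<^bsub>as_group G\<^esub> level_stab G n \<subseteq> ?C ` (?W \<rightarrow>\<^sub>E ?W)"
    unfolding RCOSETS_def by (intro UN_least) (auto simp only:)
  moreover have "finite (?W \<rightarrow>\<^sub>E ?W)"
    using finite_lists_length_eq[of "UNIV :: bool set" n] by (intro finite_PiE) auto
  ultimately show ?thesis
    using subgroup_level_stab[OF G] by (simp add: finite_index_def finite_subset)
qed

lemma dense_imp_agree:
  assumes G: "subgroup G AutT" and dense: "profinitely_dense (as_group G) H" and g: "g \<in> G"
  shows "\<exists>h\<in>H. agree n g h"
proof -
  have "\<exists>h\<in>H. h \<in> g <#\<^bsub>as_group G\<^esub> level_stab G n"
    using dense g normal_level_stab[OF G] finite_index_level_stab[OF G]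
    by (simp add: profinitely_dense_iff[OF subgroup.subgroup_is_group[OF G group_AutT]])
  then obtain h k where "h \<in> H" "h = g \<circ> k" "k \<in> level_stab G n"
    by (auto simp: l_coset_def AutT_comp_one)
  then show ?thesis by (intro bexI[of _ h]) (simp_all add: level_stab_def agree_def)
qed

text \<open>The congruence subgroup property makes agreement on all levels sufficient for profinite
  density: two elements that agree on a deep enough level lie in the same coset of a given
  finite-index normal subgroup.\<close>

lemma agree_imp_dense:
  assumes G: "subgroup G AutT" and csp: "congruence_subgroup_property G" and HG: "H \<subseteq> G"
    and approx: "\<And>n g. g \<in> G \<Longrightarrow> \<exists>h\<in>H. agree n g h"
  shows "profinitely_dense (as_group G) H"
proof -
  have "\<exists>h\<in>H. h \<in> g <#\<^bsub>as_group G\<^esub> N"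
    if g: "g \<in> G" and N: "finite_index (as_group G) N" for g N
  proof -
    obtain n where n: "level_stab G n \<subseteq> N"
      using csp N by (auto simp: congruence_subgroup_property_def)
    obtain h where h: "h \<in> H" "agree n g h" using approx[OF g] by blast
    have gc: "g \<in> carrier AutT" using subgroup.mem_carrier[OF G g] .
    have "inv\<^bsub>AutT\<^esub> g \<circ> h \<in> G"
      using subgroup.m_closed[OF G subgroup.m_inv_closed[OF G g], of h] h HG
      by (auto simp: AutT_comp_one)
    moreover have "(inv\<^bsub>AutT\<^esub> g \<circ> h) w = w" if "length w = n" for w
    proof -
      have "h w = g w" using h(2) that by (simp add: agree_def)
      then show ?thesis using inv_AutT(3)[OF gc] by simp
    qed
    ultimately have "inv\<^bsub>AutT\<^esub> g \<circ> h \<in> N" using n by (auto simp: level_stab_def)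
    moreover have "h = g \<circ> (inv\<^bsub>AutT\<^esub> g \<circ> h)" using inv_AutT(2)[OF gc] by auto
    ultimately show ?thesis using h(1) by (auto simp: l_coset_def AutT_comp_one)
  qed
  then show ?thesis
    using HG by (simp add: profinitely_dense_iff[OF subgroup.subgroup_is_group[OF G group_AutT]])
qed

section \<open>Approximation in Basilica groups\<close>

text \<open>One step of \<open>\<beta>\<close> uses up a letter of the word and passes to at most a first-level section,
  so evaluation at a word of length \<open>n\<close> only sees the action on levels up to \<open>n\<close>.\<close>

lemma beta_agree_le:
  assumes "g \<in> carrier AutT" "h \<in> carrier AutT" "\<And>m. m \<le> length w \<Longrightarrow> agree m g h"
  shows "beta s i g w = beta s i h w"
  using assms
proof (induction s i g w arbitrary: h rule: beta.induct)
  case (2 s g x w)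
  have "root_perm g x = root_perm h x"
    using 2(4)[of 1] by (simp add: agree_def root_perm_def)
  moreover have "agree m (sect g [x]) (sect h [x])" if "m \<le> length w" for m
    unfolding agree_def
  proof (intro allI impI)
    fix u :: vertex assume "length u = m"
    then have "g [x] = h [x]" "g ([x] @ u) = h ([x] @ u)"
      using 2(4)[of 1] 2(4)[of "Suc m"] that by (simp_all add: agree_def)
    then show "sect g [x] u = sect h [x] u"
      using sect_append[OF 2(2), of "[x]" u] sect_append[OF 2(3), of "[x]" u] by simp
  qed
  ultimately show ?case
    using 2(1)[OF sect_in_AutT[OF 2(2)] sect_in_AutT[OF 2(3)]] by simp
qed auto

lemma beta_agree:
  assumes "g \<in> carrier AutT" "h \<in> carrier AutT" "agree n g h"
  shows "agree n (beta s i g) (beta s i h)"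
  using assms beta_agree_le agree_le unfolding agree_def[of n "beta s i g"] by blast

theorem theorem1p2:
  fixes G H :: "(vertex \<Rightarrow> vertex) set" and s :: nat
  assumes "subgroup G AutT"
    and "branch_group G"
    and "congruence_subgroup_property G"
    and "s \<ge> 2"
    and "congruence_subgroup_property (Bas s G)"
    and "subgroup H (as_group G)"
    and "profinitely_dense (as_group G) H"
  shows "profinitely_dense (as_group (Bas s G)) (Bas s H)"
proof (rule agree_imp_dense[OF subgroup_Bas[OF assms(1)] assms(5)])
  have HG: "H \<subseteq> G" using subgroup.subset[OF assms(6)] by simp
  have GA: "G \<subseteq> carrier AutT" using subgroup.subset[OF assms(1)] .
  show "Bas s H \<subseteq> Bas s G"
    unfolding Bas_def using HG by (intro group.mono_generate[OF group_AutT]) auto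
  fix n g assume "g \<in> Bas s G"
  then show "\<exists>h\<in>Bas s H. agree n g h"
    unfolding Bas_def
  proof (rule generate_agree[rotated 3])
    fix a assume "a \<in> {beta s i g | i g. g \<in> G \<and> i \<le> s - 1}"
    then obtain i g where a: "a = beta s i g" "g \<in> G" "i \<le> s - 1" by blast
    obtain h where "h \<in> H" "agree n g h"
      using dense_imp_agree[OF assms(1,7) a(2)] by blast
    then show "\<exists>b\<in>{beta s i g | i g. g \<in> H \<and> i \<le> s - 1}. agree n a b"
      using a HG GA beta_agree by blast
  qed (use HG GA beta_in_AutT in auto)
qed

end
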